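(* For any integer $n\geq 0$, there exists a (weight-preserving) bijection $\theta$ between $\mathcal{G}_n^{\mathbf{uvu,uu}}(a,b,b^2)$ and $\mathcal{M}_{n}(a+b,ab)$.
   Context: A G-Motzkin path of length $n$ is a lattice path from $(0,0)$ to $(n,0)$ in the first quadrant (never going below the $x$-axis) consisting of up steps $\mathbf{u}=(1,1)$, down steps $\mathbf{d}=(1,-1)$, horizontal steps $\mathbf{h}=(1,0)$ and vertical steps $\mathbf{v}=(0,-1)$. Here $a,b$ are commuting indeterminates. An $(a,b,c)$-G-Motzkin path is a G-Motzkin path in which each $\mathbf{u}$-, $\mathbf{h}$-, $\mathbf{v}$-, $\mathbf{d}$-step has weight $1,a,b,c$ respectively. $\mathcal{G}_n^{\mathbf{uvu,uu}}(a,b,b^2)$ is the set of all $(a,b,b^2)$-G-Motzkin paths of length $n$ that contain neither three consecutive steps $\mathbf{u},\mathbf{v},\mathbf{u}$ nor two consecutive steps $\mathbf{u},\mathbf{u}$. A Motzkin path of length $n$ is a G-Motzkin path of length $n$ with no $\mathbf{v}$-steps. An $(\alpha,\beta)$-Motzkin path is a Motzkin path in which each $\mathbf{u}$-, $\mathbf{h}$-, $\mathbf{d}$-step has weight $1,\alpha,\beta$ respectively; $\mathcal{M}_n(\alpha,\beta)$ is the set of $(\alpha,\beta)$-Motzkin paths of length $n$. Convention: in $\mathcal{M}_n(a+b,ab)$, an $\mathbf{h}$-step of weight $a+b$ is regarded as coming in two kinds, $\mathbf{h}_a$ of weight $a$ and $\mathbf{h}_b$ of weight $b$; so an element of $\mathcal{M}_n(a+b,ab)$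 is a Motzkin path of length $n$ together with a choice, for each $\mathbf{h}$-step, of weight $a$ or $b$, each $\mathbf{d}$-step having weight $ab$. The weight of a path is the product of the weights of its steps; a bijection is weight-preserving if every path and its image have the same weight. *)

theory Defs
  imports Main "HOL-Library.Sublist" "HOL-Library.Product_Plus"
    "HOL-Computational_Algebra.Polynomial"
begin

datatype step = U | D | H | V

fun step_vec :: "step \<Rightarrow> int \<times> int" where
  "step_vec U = (1, 1)"
| "step_vec D = (1, -1)"
| "step_vec H = (1, 0)"
| "step_vec V = (0, -1)"

definition endpoint :: "step list \<Rightarrow> int \<times> int" where
  "endpoint p = sum_list (map step_vec p)"

text \<open>The length is the abscissa of the final point, not the number of steps: vertical
  steps do not contribute to it.\<close>

definition gmotzkin :: "nat \<Rightarrow> step list \<Rightarrow> bool" where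
  "gmotzkin n p \<longleftrightarrow> endpoint p = (int n, 0) \<and>
     (\<forall>q. prefix q p \<longrightarrow> 0 \<le> fst (endpoint q) \<and> 0 \<le> snd (endpoint q))"

definition motzkin :: "nat \<Rightarrow> step list \<Rightarrow> bool" where
  "motzkin n p \<longleftrightarrow> gmotzkin n p \<and> V \<notin> set p"

text \<open>\<^const>\<open>sublist\<close> refers to consecutive entries.\<close>

definition G_uvu_uu :: "nat \<Rightarrow> step list set" where
  "G_uvu_uu n = {p. gmotzkin n p \<and> \<not> sublist [U, V, U] p \<and> \<not> sublist [U, U] p}"

fun gstep_weight :: "'r::comm_semiring_1 \<Rightarrow> 'r \<Rightarrow> 'r \<Rightarrow> step \<Rightarrow> 'r" where
  "gstep_weight a b c U = 1"
| "gstep_weight a b c H = a"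
| "gstep_weight a b c V = b"
| "gstep_weight a b c D = c"

definition gweight :: "'r::comm_semiring_1 \<Rightarrow> 'r \<Rightarrow> 'r \<Rightarrow> step list \<Rightarrow> 'r" where
  "gweight a b c p = prod_list (map (gstep_weight a b c) p)"

text \<open>A Motzkin path whose horizontal steps have weight \<open>a + b\<close> is encoded as a path in which
  each horizontal step is of one of two kinds, \<open>CHa\<close> of weight \<open>a\<close> and \<open>CHb\<close> of weight \<open>b\<close>.\<close>

datatype cstep = CU | CD | CHa | CHb

fun uncolour :: "cstep \<Rightarrow> step" where
  "uncolour CU = U"
| "uncolour CD = D"
| "uncolour CHa = H"
| "uncolour CHb = H"

definition M_coloured :: "nat \<Rightarrow> cstep list set" where
  "M_coloured n = {p. motzkin n (map uncolour p)}"

fun cstep_weight :: "'r::comm_semiring_1 \<Rightarrow> 'r \<Rightarrow> 'r \<Rightarrow> cstep \<Rightarrow> 'r" where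
  "cstep_weight a b c CU = 1"
| "cstep_weight a b c CHa = a"
| "cstep_weight a b c CHb = b"
| "cstep_weight a b c CD = c"

definition cweight :: "'r::comm_semiring_1 \<Rightarrow> 'r \<Rightarrow> 'r \<Rightarrow> cstep list \<Rightarrow> 'r" where
  "cweight a b c p = prod_list (map (cstep_weight a b c) p)"

text \<open>The two commuting indeterminates, as elements of \<open>\<int>[a][b]\<close>.\<close>

definition ind_a :: "int poly poly" where
  "ind_a = [:[:0, 1:]:]"

definition ind_b :: "int poly poly" where
  "ind_b = [:0, 1:]"

end

theory Submission
  imports Defs
begin

text \<open>Split a coloured Motzkin path at its first step, and at the first return to the axis if that
  step is up: with \<open>x\<close> marking the length, the generating function \<open>M\<close> satisfies
  \<open>M = 1 + a x M + b x M + a b x^2 M^2\<close>.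
  Substituting this equation once into the factor \<open>M\<close> of the term \<open>b x M\<close> gives
  \<open>M = 1 + a x M + a b x^2 M^2 + b x (1 + a x M + b x M + a b x^2 M^2)\<close>,
  whose terms are the decompositions of a G-Motzkin path that avoids \<open>uvu\<close> and \<open>uu\<close>.
  Indeed, such a path is empty, or is \<open>h P\<close>, or starts with \<open>u\<close>, which must then be
  followed by \<open>h\<close>, \<open>v\<close> or \<open>d\<close>. Following the height down to where it was before that \<open>u\<close>
  leaves the forms \<open>u h P v Q\<close>, \<open>u v\<close>, \<open>u v h P\<close>, \<open>u d P\<close>, \<open>u h P d Q\<close>, with weights
  \<open>a b x^2\<close>, \<open>b x\<close>, \<open>a b x^2\<close>, \<open>b^2 x^2\<close>, \<open>a b^2 x^3\<close>; and \<open>P\<close>, \<open>Q\<close> are arbitrary avoiding paths.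

  Both families are therefore parametrised by one type of trees, \<open>shape\<close>, with a constructor
  for each term of the first equation, and the second equation says how to read a tree as a
  G-Motzkin path. Each reading is shown to be injective (\<open>gpath_unique\<close>,
  \<open>cpath_unique\<close>) and onto the family (\<open>gpath_parse\<close>, \<open>cpath_parse\<close>), and the two readings of
  a tree have the same length and weight. The bijection turns a G-Motzkin path into its tree
  and reads that tree as a coloured Motzkin path.\<close>

section \<open>Paths as height sequences\<close>

text \<open>Starting from height \<open>h\<close>, the path never goes below the axis and ends on it. A starting
  height other than \<open>0\<close> is what makes recursion along the path possible.\<close>

fun lands :: "int \<Rightarrow> step list \<Rightarrow> bool" where
  "lands h [] \<longleftrightarrow> h = 0"
| "lands h (s # p) \<longleftrightarrow> 0 \<le> h + snd (step_vec s) \<and> lands (h + snd (step_vec s)) p"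

lemma endpoint_simps [simp]:
  "endpoint [] = 0"
  "endpoint (s # p) = step_vec s + endpoint p"
  "endpoint (p @ q) = endpoint p + endpoint q"
  by (simp_all add: endpoint_def)

lemma fst_endpoint_nonneg: "0 \<le> fst (endpoint p)"
proof (induction p)
  case (Cons s p)
  then show ?case by (cases s) auto
qed simp

lemma lands_iff:
  assumes "0 \<le> h"
  shows "lands h p \<longleftrightarrow>
    h + snd (endpoint p) = 0 \<and> (\<forall>q. prefix q p \<longrightarrow> 0 \<le> h + snd (endpoint q))"
  using assms
proof (induction p arbitrary: h)
  case (Cons s p)
  let ?k = "h + snd (step_vec s)"
  have prefixes: "(\<forall>q. prefix q (s # p) \<longrightarrow> 0 \<le> h + snd (endpoint q)) \<longleftrightarrow>
      (\<forall>q. prefix q p \<longrightarrow> 0 \<le> ?k + snd (endpoint q))"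
    using Cons.prems by (auto simp: prefix_Cons add.assoc)
  show ?case
  proof (cases "0 \<le> ?k")
    case True
    then show ?thesis using Cons.IH[of ?k] prefixes by (simp add: add.assoc)
  next
    case False
    then have "\<not> (\<forall>q. prefix q p \<longrightarrow> 0 \<le> ?k + snd (endpoint q))"
      by (intro notI) (auto dest: spec[of _ "[]"])
    then show ?thesis using False prefixes by simp
  qed
qed simp

lemma gmotzkin_iff: "gmotzkin n p \<longleftrightarrow> lands 0 p \<and> fst (endpoint p) = int n"
  unfolding gmotzkin_def lands_iff[OF order_refl]
  by (auto simp: prod_eq_iff fst_endpoint_nonneg)

definition avoiding :: "step list \<Rightarrow> bool" where
  "avoiding p \<longleftrightarrow> \<not> sublist [U, V, U] p \<and> \<not> sublist [U, U] p"

lemma avoiding_simps [simp]: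
  "avoiding []"
  "avoiding (D # p) \<longleftrightarrow> avoiding p"
  "avoiding (H # p) \<longleftrightarrow> avoiding p"
  "avoiding (V # p) \<longleftrightarrow> avoiding p"
  "avoiding (U # p) \<longleftrightarrow> \<not> prefix [V, U] p \<and> \<not> prefix [U] p \<and> avoiding p"
  by (auto simp: avoiding_def sublist_Cons_right)

section \<open>Trees and their two readings\<close>

datatype shape = Stop | LevelA shape | LevelB shape | Arch shape shape

fun cpath :: "shape \<Rightarrow> cstep list" where
  "cpath Stop = []"
| "cpath (LevelA t) = CHa # cpath t"
| "cpath (LevelB t) = CHb # cpath t"
| "cpath (Arch s t) = CU # cpath s @ CD # cpath t"

text \<open>A level step of weight \<open>b\<close> is read together with the constructor below it; the four
  clauses for \<open>LevelB\<close> are the terms of \<open>b x (1 + a x M + b x M + a b x^2 M^2)\<close>.\<close>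

fun gpath :: "shape \<Rightarrow> step list" where
  "gpath Stop = []"
| "gpath (LevelA t) = H # gpath t"
| "gpath (Arch s t) = U # H # gpath s @ V # gpath t"
| "gpath (LevelB Stop) = [U, V]"
| "gpath (LevelB (LevelA t)) = U # V # H # gpath t"
| "gpath (LevelB (LevelB t)) = U # D # gpath t"
| "gpath (LevelB (Arch s t)) = U # H # gpath s @ D # gpath t"

lemma fst_endpoint_gpath:
  "fst (endpoint (gpath t)) = fst (endpoint (map uncolour (cpath t)))"
  by (induction t rule: gpath.induct) auto

lemma gweight_gpath:
  fixes a b :: "'r::comm_semiring_1"
  shows "gweight a b (b\<^sup>2) (gpath t) = cweight a b (a * b) (cpath t)"
  by (induction t rule: gpath.induct)
    (simp_all add: gweight_def cweight_def power2_eq_square mult_ac)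

section \<open>Unique readability\<close>

text \<open>What may follow a complete excursion inside a longer path: nothing, or the step that leaves
  the starting level of the excursion downwards.\<close>

fun falls :: "step list \<Rightarrow> bool" where
  "falls [] \<longleftrightarrow> True"
| "falls (s # p) \<longleftrightarrow> s = V \<or> s = D"

lemma lands_cpath_append:
  "0 \<le> h \<Longrightarrow> lands h (map uncolour (cpath t) @ r) \<longleftrightarrow> lands h r"
  by (induction t arbitrary: h r) auto

lemma lands_gpath_append: "0 \<le> h \<Longrightarrow> lands h (gpath t @ r) \<longleftrightarrow> lands h r"
  by (induction t arbitrary: h r rule: gpath.induct) auto

text \<open>The suffix \<open>r\<close> is there for the induction. It must not start with \<open>u\<close>, because
  \<open>gpath (LevelB Stop)\<close> is \<open>u v\<close>.\<close>

lemma avoiding_gpath_append: "falls r \<Longrightarrow> avoiding r \<Longrightarrow> avoiding (gpath t @ r)"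
proof (induction t arbitrary: r rule: gpath.induct)
  case 4
  then show ?case by (cases r) auto
qed auto

text \<open>Reading from the left, an excursion is complete as soon as an unmatched down step or the
  end of the list appears, so no information on heights is needed to recover the tree.\<close>

lemma cpath_unique:
  assumes "cpath s @ x = cpath t @ y"
    and "falls (map uncolour x)" and "falls (map uncolour y)"
  shows "s = t \<and> x = y"
  using assms
proof (induction s arbitrary: t x y)
  case Stop
  then show ?case by (cases t) auto
next
  case (LevelA s)
  then show ?case by (cases t) auto
next
  case (LevelB s)
  then show ?case by (cases t) auto
next
  case (Arch s1 s2)
  note IH = Arch.IH and prems = Arch.prems
  show ?case
  proof (cases t)
    case (Arch t1 t2)
    then have "cpath s1 @ CD # cpath s2 @ x = cpath t1 @ CD # cpath t2 @ y"
      using prems by simp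
    then have inner: "s1 = t1 \<and> CD # cpath s2 @ x = CD # cpath t2 @ y"
      by (intro IH(1)) simp_all
    then have "s2 = t2 \<and> x = y"
      using prems by (intro IH(2)) simp_all
    then show ?thesis using Arch inner by simp
  qed (use prems in auto)
qed

text \<open>The first three steps separate all clauses of \<open>gpath\<close> but two: the readings of
  \<open>Arch s t\<close> and \<open>LevelB (Arch s t)\<close> both begin with \<open>u h\<close>. They differ in the step that
  ends the inner excursion, whose position is determined by the induction hypothesis.\<close>

lemma gpath_unique:
  assumes "gpath s @ x = gpath t @ y" and "falls x" and "falls y"
  shows "s = t \<and> x = y"
  using assms
proof (induction s arbitrary: t x y rule: gpath.induct)
  case 1
  then show ?case by (cases t rule: gpath.cases) auto
next
  case (2 s)
  then show ?case by (cases t rule: gpath.cases) auto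
next
  case (3 s1 s2)
  have inner: "s1 = t1 \<and> V # gpath s2 @ x = d # r"
    if "gpath s1 @ V # gpath s2 @ x = gpath t1 @ d # r" "falls (d # r)" for t1 d r
    using that by (intro "3.IH"(1)) simp_all
  have after: "s2 = t2 \<and> x = y" if "gpath s2 @ x = gpath t2 @ y" for t2
    using that "3.prems"(2,3) by (rule "3.IH"(2))
  show ?case
    using "3.prems"(1,3)
    by (cases t rule: gpath.cases) (auto dest!: after inner[where d = V] inner[where d = D])
next
  case 4
  then show ?case by (cases t rule: gpath.cases) auto
next
  case (5 s)
  then show ?case by (cases t rule: gpath.cases) auto
next
  case (6 s)
  then show ?case by (cases t rule: gpath.cases) auto
next
  case (7 s1 s2)
  have inner: "s1 = t1 \<and> D # gpath s2 @ x = d # r"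
    if "gpath s1 @ D # gpath s2 @ x = gpath t1 @ d # r" "falls (d # r)" for t1 d r
    using that by (intro "7.IH"(1)) simp_all
  have after: "s2 = t2 \<and> x = y" if "gpath s2 @ x = gpath t2 @ y" for t2
    using that "7.prems"(2,3) by (rule "7.IH"(2))
  show ?case
    using "7.prems"(1,3)
    by (cases t rule: gpath.cases) (auto dest!: after inner[where d = V] inner[where d = D])
qed

lemma inj_cpath: "inj cpath"
  using cpath_unique[where x = "[]" and y = "[]"] by (auto intro: injI)

lemma inj_gpath: "inj gpath"
  using gpath_unique[where x = "[]" and y = "[]"] by (auto intro: injI)

section \<open>Every path comes from a tree\<close>

lemma falls_lands_pos:
  assumes "falls r" and "lands h r" and "0 < h"
  obtains d r' where "r = d # r'" "d = V \<or> d = D" "lands (h - 1) r'"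
  using assms by (cases r) auto

text \<open>A path that starts at height \<open>h\<close> and lands on the axis splits off a maximal initial
  excursion above level \<open>h\<close>. Stating this for every \<open>h\<close> yields the first-return
  decomposition: after an up step, the excursion above level \<open>h + 1\<close> must be followed by a
  down step, and the remaining list is again at height \<open>h\<close>.\<close>

lemma cpath_parse:
  assumes "lands h (map uncolour p)" and "0 \<le> h"
  shows "\<exists>t r. p = cpath t @ r \<and> falls (map uncolour r)"
  using assms
proof (induction p arbitrary: h rule: length_induct)
  case (1 p)
  note IH = "1.IH"[rule_format]
  show ?case
  proof (cases p)
    case Nil
    then have "p = cpath Stop @ []" by simp
    then show ?thesis by fastforce
  next
    case (Cons s q)
    show ?thesis
    proof (cases s)
      case CU
      then have "lands (h + 1) (map uncolour q)" using Cons "1.prems" by simp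
      then obtain t1 r1 where q: "q = cpath t1 @ r1" and falls: "falls (map uncolour r1)"
        using IH[of q "h + 1"] Cons "1.prems" by auto
      have "lands (h + 1) (map uncolour r1)"
        using \<open>lands (h + 1) (map uncolour q)\<close> "1.prems" by (simp add: q lands_cpath_append)
      with falls obtain d r' where r': "map uncolour r1 = d # r'" "lands h r'" "d = V \<or> d = D"
        using "1.prems" by (auto elim: falls_lands_pos)
      then obtain c r2 where r1: "r1 = c # r2" "uncolour c = d" "map uncolour r2 = r'"
        by auto
      with r' have "c = CD" by (cases c) auto
      obtain t2 r where "r2 = cpath t2 @ r" "falls (map uncolour r)"
        using IH[of r2 h] Cons q r1 r' "1.prems" by auto
      then have "p = cpath (Arch t1 t2) @ r" using Cons CU q r1 \<open>c = CD\<close> by simp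
      with \<open>falls (map uncolour r)\<close> show ?thesis by blast
    next
      case CD
      then have "p = cpath Stop @ p \<and> falls (map uncolour p)" using Cons by simp
      then show ?thesis by blast
    next
      case CHa
      then obtain t r where "q = cpath t @ r" "falls (map uncolour r)"
        using IH[of q h] Cons "1.prems" by auto
      then have "p = cpath (LevelA t) @ r" using Cons CHa by simp
      with \<open>falls (map uncolour r)\<close> show ?thesis by blast
    next
      case CHb
      then obtain t r where "q = cpath t @ r" "falls (map uncolour r)"
        using IH[of q h] Cons "1.prems" by auto
      then have "p = cpath (LevelB t) @ r" using Cons CHb by simp
      with \<open>falls (map uncolour r)\<close> show ?thesis by blast
    qed
  qed
qed

lemma avoiding_appendD: "avoiding (p @ q) \<Longrightarrow> avoiding q"
  by (induction p) (auto simp: avoiding_def sublist_Cons_right)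

text \<open>Here the induction hypothesis is applied past a whole initial block \<open>h\<close>, \<open>u h\<close>, \<open>u v h\<close> or
  \<open>u d\<close>. As \<open>uu\<close> and \<open>uvu\<close> are forbidden, the only other way to start with \<open>u\<close> is
  \<open>u v\<close> with nothing or a down step after it, and then \<open>u v\<close> is the whole excursion.\<close>

lemma gpath_parse:
  assumes "lands h p" and "0 \<le> h" and "avoiding p"
  shows "\<exists>t r. p = gpath t @ r \<and> falls r"
  using assms
proof (induction p arbitrary: h rule: length_induct)
  case (1 p)
  note IH = "1.IH"[rule_format]
  show ?case
  proof (cases p)
    case Nil
    then have "p = gpath Stop @ [] \<and> falls []" by simp
    then show ?thesis by blast
  next
    case (Cons s q)
    show ?thesis
    proof (cases s)
      case H
      then obtain t r where "q = gpath t @ r" "falls r"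
        using IH[of q h] Cons "1.prems" by auto
      then have "p = gpath (LevelA t) @ r" using Cons H by simp
      with \<open>falls r\<close> show ?thesis by blast
    next
      case D
      then have "p = gpath Stop @ p \<and> falls p" using Cons by simp
      then show ?thesis by blast
    next
      case V
      then have "p = gpath Stop @ p \<and> falls p" using Cons by simp
      then show ?thesis by blast
    next
      case U
      with Cons "1.prems" obtain s' q' where q: "q = s' # q'" by (cases q) auto
      show ?thesis
      proof (cases s')
        case U
        then show ?thesis using \<open>s = U\<close> Cons q "1.prems" by simp
      next
        case D
        then obtain t r where "q' = gpath t @ r" "falls r"
          using IH[of q' h] \<open>s = U\<close> Cons q "1.prems" by auto
        then have "p = gpath (LevelB (LevelB t)) @ r" using \<open>s = U\<close> Cons q D by simp
        with \<open>falls r\<close> show ?thesis by blast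
      next
        case H
        then have q': "lands (h + 1) q'" "avoiding q'"
          using \<open>s = U\<close> Cons q "1.prems" by auto
        then obtain t1 r1 where r1: "q' = gpath t1 @ r1" "falls r1"
          using IH[of q' "h + 1"] Cons q "1.prems" by auto
        have "lands (h + 1) r1"
          using q' r1 "1.prems" by (simp add: lands_gpath_append)
        then obtain d r2 where r2: "r1 = d # r2" "d = V \<or> d = D" "lands h r2"
          using \<open>falls r1\<close> "1.prems" by (auto elim: falls_lands_pos)
        have "avoiding r2"
          using q' r1 r2 avoiding_appendD[of "gpath t1 @ [d]" r2] by simp
        then obtain t2 r where r: "r2 = gpath t2 @ r" "falls r"
          using IH[of r2 h] Cons q r1 r2 "1.prems" by auto
        then have "p = gpath (Arch t1 t2) @ r \<or> p = gpath (LevelB (Arch t1 t2)) @ r"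
          using \<open>s = U\<close> Cons q H r1 r2 by auto
        with \<open>falls r\<close> show ?thesis by blast
      next
        case V
        show ?thesis
        proof (cases "falls q'")
          case True
          have "p = gpath (LevelB Stop) @ q'" using \<open>s = U\<close> Cons q V by simp
          with True show ?thesis by blast
        next
          case False
          \<comment> \<open>The next step is not \<open>u\<close> since \<open>uvu\<close> is forbidden, and so it is \<open>h\<close>.\<close>
          then obtain q'' where q'': "q' = H # q''"
            using \<open>s = U\<close> Cons q V "1.prems" by (cases q' rule: falls.cases; cases "hd q'") auto
          then obtain t r where "q'' = gpath t @ r" "falls r"
            using IH[of q'' h] \<open>s = U\<close> Cons q V "1.prems" by auto
          then have "p = gpath (LevelB (LevelA t)) @ r" using \<open>s = U\<close> Cons q V q'' by simp
          with \<open>falls r\<close> show ?thesis by blast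
        qed
      qed
    qed
  qed
qed

section \<open>The bijection\<close>

lemma falls_lands_0: "falls r \<Longrightarrow> lands 0 r \<Longrightarrow> r = []"
  by (cases r) auto

lemma range_cpath: "range cpath = {p. lands 0 (map uncolour p)}"
proof (intro equalityI subsetI)
  fix p assume "p \<in> range cpath"
  then show "p \<in> {p. lands 0 (map uncolour p)}"
    using lands_cpath_append[of 0 _ "[]"] by auto
next
  fix p assume p: "p \<in> {p. lands 0 (map uncolour p)}"
  then obtain t r where t: "p = cpath t @ r" "falls (map uncolour r)"
    using cpath_parse[of 0 p] by auto
  then have "map uncolour r = []"
    using p by (intro falls_lands_0) (simp_all add: lands_cpath_append)
  then show "p \<in> range cpath" using t by simp
qed

lemma range_gpath: "range gpath = {p. lands 0 p \<and> avoiding p}"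
proof (intro equalityI subsetI)
  fix p assume "p \<in> range gpath"
  then show "p \<in> {p. lands 0 p \<and> avoiding p}"
    using lands_gpath_append[of 0 _ "[]"] avoiding_gpath_append[of "[]"] by auto
next
  fix p assume p: "p \<in> {p. lands 0 p \<and> avoiding p}"
  then obtain t r where t: "p = gpath t @ r" "falls r"
    using gpath_parse[of 0 p] by auto
  then have "r = []"
    using p by (intro falls_lands_0) (simp_all add: lands_gpath_append)
  then show "p \<in> range gpath" using t by simp
qed

lemma V_notin_uncolour: "V \<notin> set (map uncolour p)"
proof (induction p)
  case (Cons c p)
  then show ?case by (cases c) auto
qed simp

definition shapes :: "nat \<Rightarrow> shape set" where
  "shapes n = {t. fst (endpoint (map uncolour (cpath t))) = int n}"

lemma bij_betw_cpath: "bij_betw cpath (shapes n) (M_coloured n)"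
proof -
  have "M_coloured n =
      {p \<in> range cpath. fst (endpoint (map uncolour p)) = int n}"
    unfolding M_coloured_def motzkin_def gmotzkin_iff range_cpath
    using V_notin_uncolour by auto
  also have "\<dots> = cpath ` shapes n" by (auto simp: shapes_def)
  finally show ?thesis using inj_cpath by (auto simp: bij_betw_def inj_on_def)
qed

lemma bij_betw_gpath: "bij_betw gpath (shapes n) (G_uvu_uu n)"
proof -
  have "G_uvu_uu n = {p \<in> range gpath. fst (endpoint p) = int n}"
    unfolding G_uvu_uu_def gmotzkin_iff range_gpath avoiding_def by auto
  also have "\<dots> = gpath ` shapes n" by (auto simp: shapes_def fst_endpoint_gpath)
  finally show ?thesis using inj_gpath by (auto simp: bij_betw_def inj_on_def)
qed

theorem theorem3p1:
  fixes n :: nat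
  shows "\<exists>\<theta> :: step list \<Rightarrow> cstep list.
    bij_betw \<theta> (G_uvu_uu n) (M_coloured n) \<and>
    (\<forall>p \<in> G_uvu_uu n.
       cweight ind_a ind_b (ind_a * ind_b) (\<theta> p) = gweight ind_a ind_b (ind_b\<^sup>2) p)"
proof (intro exI conjI ballI)
  let ?tree = "inv_into (shapes n) gpath"
  show "bij_betw (cpath \<circ> ?tree) (G_uvu_uu n) (M_coloured n)"
    using bij_betw_inv_into[OF bij_betw_gpath] bij_betw_cpath by (rule bij_betw_trans)
  fix p assume "p \<in> G_uvu_uu n"
  then have "gpath (?tree p) = p"
    using bij_betw_inv_into_right[OF bij_betw_gpath] by blast
  then show "cweight ind_a ind_b (ind_a * ind_b) ((cpath \<circ> ?tree) p) =
      gweight ind_a ind_b (ind_b\<^sup>2) p"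
    using gweight_gpath[of ind_a ind_b "?tree p"] by simp
qed

end
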